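(* Let $G$ be a group with a finite symmetric set of generators $S$, $e\notin S$, which is $\delta$-hyperbolic with respect to the word metric $d_S$, for some real $\delta\geq 0$. Then $G$ has only a finite number of conjugacy classes of finite subgroups.
   Context: Word metric: $S$ is a finite generating set of $G$ with $S=S^{-1}$ and $e\notin S$. For $x,y\in G$, $d_S(x,y)$ is the minimal number $n$ such that $x^{-1}y=s_1\cdots s_n$ with $s_i\in S$. This is a left-invariant metric on $G$. Hyperbolicity: A metric space $X$ with metric $d(\cdot,\cdot)$ is $\delta$-hyperbolic ($\delta\ge 0$) if for all $x,y,z,t\in X$, $d(x,y)+d(z,t)\le\max\{d(x,z)+d(y,t),\,d(x,t)+d(y,z)\}+2\delta$. The group $G$ is $\delta$-hyperbolic (relative to $S$) if the metric space $(G,d_S)$ is $\delta$-hyperbolic. *)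

theory Defs
  imports Complex_Main "HOL-Algebra.Algebra"
begin

(* Only meaningful for x, y in the subgroup generated by S with S symmetric: otherwise no
   positive word in S need represent inv x * y, and LEAST returns an unspecified number. *)
definition word_metric :: "('a, 'b) monoid_scheme \<Rightarrow> 'a set \<Rightarrow> 'a \<Rightarrow> 'a \<Rightarrow> real" where
  "word_metric G S x y =
     real (LEAST n. \<exists>ws. length ws = n \<and> set ws \<subseteq> S \<and>
       foldr (\<otimes>\<^bsub>G\<^esub>) ws \<one>\<^bsub>G\<^esub> = inv\<^bsub>G\<^esub> x \<otimes>\<^bsub>G\<^esub> y)"

(* The metric axioms are not part of this predicate: the locale Metric_space demands symmetry
   and non-negativity of d on the whole type rather than just on M. *)
definition hyperbolic_space :: "'a set \<Rightarrow> ('a \<Rightarrow> 'a \<Rightarrow> real) \<Rightarrow> real \<Rightarrow> bool" where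
  "hyperbolic_space M d \<delta> \<longleftrightarrow>
     (\<forall>x\<in>M. \<forall>y\<in>M. \<forall>z\<in>M. \<forall>t\<in>M.
        d x y + d z t \<le> max (d x z + d y t) (d x t + d y z) + 2 * \<delta>)"

definition conjugate_subgroup :: "('a, 'b) monoid_scheme \<Rightarrow> 'a \<Rightarrow> 'a set \<Rightarrow> 'a set" where
  "conjugate_subgroup G g H = g <#\<^bsub>G\<^esub> H #>\<^bsub>G\<^esub> inv\<^bsub>G\<^esub> g"

definition finite_subgroups :: "('a, 'b) monoid_scheme \<Rightarrow> 'a set set" where
  "finite_subgroups G = {H. subgroup H G \<and> finite H}"

end

theory Submission
  imports Defs
begin

text \<open>
  A finite subgroup \<open>H\<close> acts on \<open>G\<close> by left translations, which are isometries preserving the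
  bounded set \<open>H\<close>; so it permutes the \<^emph>\<open>centres\<close> of \<open>H\<close>, the points \<open>x\<close> whose farthest distance
  to \<open>H\<close> is as small as possible. In a hyperbolic space with approximate midpoints two centres
  \<open>x\<close>, \<open>y\<close> are close to each other, since otherwise an approximate midpoint would be closer to
  all of \<open>H\<close> than a centre is (\<open>hyperbolic_near_centres\<close>). In the word metric, where a shortest
  word cut in the middle gives a midpoint, the bound is \<open>4 * \<delta> + 1\<close> (\<open>centres_close\<close>).

  Hence a centre \<open>x\<close> is moved by at most \<open>4 * \<delta> + 1\<close> by each \<open>h\<close> in \<open>H\<close>, which says that
  \<open>inv x \<otimes> h \<otimes> x\<close> has length at most \<open>4 * \<delta> + 1\<close>: the conjugate of \<open>H\<close> by \<open>inv x\<close> lies in a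
  ball around \<open>\<one>\<close> whose radius does not depend on \<open>H\<close>. As \<open>S\<close> is finite this ball is finite, so
  it has only finitely many subsets, and every conjugacy class of finite subgroups contains one
  of them.
\<close>

section \<open>Near centres in hyperbolic spaces\<close>

text \<open>
  The four-point inequality for \<open>x\<close>, \<open>y\<close>, \<open>m\<close> and a point \<open>a\<close> of \<open>A\<close> that is far from \<open>m\<close>: the
  term \<open>r\<close> occurs on both sides and cancels. With \<open>m\<close> near the middle between \<open>x\<close> and \<open>y\<close>, the
  maximum on the right is about half of \<open>d x y\<close>, and the conclusion bounds \<open>d x y\<close>.
\<close>

lemma hyperbolic_near_centres:
  fixes d :: "'a \<Rightarrow> 'a \<Rightarrow> real"
  assumes "hyperbolic_space M d \<delta>"
    and "x \<in> M" "y \<in> M" "m \<in> M" "A \<subseteq> M"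
    and "\<forall>a\<in>A. d x a \<le> r" "\<forall>a\<in>A. d y a \<le> r" "\<exists>a\<in>A. r \<le> d m a"
  shows "d x y \<le> max (d x m) (d y m) + 2 * \<delta>"
proof -
  obtain a where a: "a \<in> A" "r \<le> d m a"
    using assms by blast
  then have "d x y + d m a \<le> max (d x m + d y a) (d x a + d y m) + 2 * \<delta>"
    using assms unfolding hyperbolic_space_def by blast
  moreover have "d x a \<le> r" "d y a \<le> r"
    using assms a by auto
  ultimately show ?thesis
    using a by (simp add: max_def split: if_splits)
qed

section \<open>Word length\<close>

definition word_length :: "('a, 'b) monoid_scheme \<Rightarrow> 'a set \<Rightarrow> 'a \<Rightarrow> nat" where
  "word_length G S g =
     (LEAST n. \<exists>ws. length ws = n \<and> set ws \<subseteq> S \<and> foldr (\<otimes>\<^bsub>G\<^esub>) ws \<one>\<^bsub>G\<^esub> = g)"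

lemma word_metric_eq_word_length:
  "word_metric G S x y = real (word_length G S (inv\<^bsub>G\<^esub> x \<otimes>\<^bsub>G\<^esub> y))"
  unfolding word_metric_def word_length_def ..

lemma word_length_le:
  "set ws \<subseteq> S \<Longrightarrow> word_length G S (foldr (\<otimes>\<^bsub>G\<^esub>) ws \<one>\<^bsub>G\<^esub>) \<le> length ws"
  unfolding word_length_def by (rule Least_le) blast

lemma (in monoid) foldr_mult_append:
  assumes "set us \<subseteq> carrier G" "set vs \<subseteq> carrier G"
  shows "foldr (\<otimes>) (us @ vs) \<one> = foldr (\<otimes>) us \<one> \<otimes> foldr (\<otimes>) vs \<one>"
  using assms(1) by (induction us) (simp_all add: assms(2) m_assoc)

lemma (in group) inv_foldr_mult:
  assumes "set ws \<subseteq> carrier G"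
  shows "inv (foldr (\<otimes>) ws \<one>) = foldr (\<otimes>) (rev (map (m_inv G) ws)) \<one>"
  using assms
proof (induction ws)
  case (Cons w ws)
  then have "set (rev (map (m_inv G) ws)) \<subseteq> carrier G"
    by auto
  with Cons show ?case
    by (simp add: foldr_mult_append inv_mult_group del: foldr_append)
qed simp

locale symmetric_generators = group G for G (structure) +
  fixes S
  assumes generators_closed: "S \<subseteq> carrier G"
    and generates: "generate G S = carrier G"
    and symmetric: "set_inv S = S"
begin

lemma inv_generator: "s \<in> S \<Longrightarrow> inv s \<in> S"
  using symmetric unfolding SET_INV_def by blast

lemma word_exists:
  assumes "g \<in> carrier G"
  shows "\<exists>ws. set ws \<subseteq> S \<and> foldr (\<otimes>) ws \<one> = g"
proof -
  have "g \<in> generate G S"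
    using assms generates by simp
  then show ?thesis
  proof induction
    case one
    show ?case
      by (rule exI[of _ "[]"]) simp
  next
    case (incl s)
    then show ?case
      using generators_closed by (intro exI[of _ "[s]"]) auto
  next
    case (inv s)
    then show ?case
      using generators_closed inv_generator by (intro exI[of _ "[inv s]"]) auto
  next
    case (eng g h)
    then obtain us vs where "set us \<subseteq> S" "foldr (\<otimes>) us \<one> = g" "set vs \<subseteq> S" "foldr (\<otimes>) vs \<one> = h"
      by blast
    then show ?case
      using generators_closed foldr_mult_append[of us vs] by (intro exI[of _ "us @ vs"]) auto
  qed
qed

lemma shortest_word:
  assumes "g \<in> carrier G"
  obtains ws where "length ws = word_length G S g" "set ws \<subseteq> S" "foldr (\<otimes>) ws \<one> = g"
proof -
  obtain ws where "set ws \<subseteq> S" "foldr (\<otimes>) ws \<one> = g"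
    using word_exists[OF assms] by blast
  then have "\<exists>n ws. length ws = n \<and> set ws \<subseteq> S \<and> foldr (\<otimes>) ws \<one> = g"
    by blast
  from LeastI_ex[OF this] show thesis
    using that unfolding word_length_def by blast
qed

lemma finite_word_length_ball:
  assumes "finite S"
  shows "finite {g \<in> carrier G. word_length G S g \<le> n}"
proof (rule finite_subset)
  show "{g \<in> carrier G. word_length G S g \<le> n}
      \<subseteq> (\<lambda>ws. foldr (\<otimes>) ws \<one>) ` {ws. set ws \<subseteq> S \<and> length ws \<le> n}"
  proof
    fix g assume g: "g \<in> {g \<in> carrier G. word_length G S g \<le> n}"
    then obtain ws where "length ws = word_length G S g" "set ws \<subseteq> S" "foldr (\<otimes>) ws \<one> = g"
      using shortest_word by blast
    with g show "g \<in> (\<lambda>ws. foldr (\<otimes>) ws \<one>) ` {ws. set ws \<subseteq> S \<and> length ws \<le> n}"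
      by (intro image_eqI[of _ _ ws]) auto
  qed
  show "finite ((\<lambda>ws. foldr (\<otimes>) ws \<one>) ` {ws. set ws \<subseteq> S \<and> length ws \<le> n})"
    using finite_lists_length_le[OF assms] by blast
qed

text \<open>
  The point reached from \<open>x\<close> by the first half of a shortest word for \<open>inv x \<otimes> y\<close>; from \<open>y\<close> it is
  reached by the inverse of the second half, which is again a word in \<open>S\<close> by symmetry.
\<close>

lemma midpoint_exists:
  assumes "x \<in> carrier G" "y \<in> carrier G"
  defines "D \<equiv> word_length G S (inv x \<otimes> y)"
  obtains m where "m \<in> carrier G"
    and "word_length G S (inv x \<otimes> m) \<le> D div 2"
    and "word_length G S (inv y \<otimes> m) \<le> D - D div 2"
proof -
  obtain ws where ws: "length ws = D" "set ws \<subseteq> S" "foldr (\<otimes>) ws \<one> = inv x \<otimes> y"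
    using shortest_word[of "inv x \<otimes> y"] assms by auto
  define us where "us = take (D div 2) ws"
  define vs where "vs = drop (D div 2) ws"
  define u where "u = foldr (\<otimes>) us \<one>"
  define v where "v = foldr (\<otimes>) vs \<one>"
  have S: "set us \<subseteq> S" "set vs \<subseteq> S"
    using ws set_take_subset set_drop_subset unfolding us_def vs_def by fast+
  then have carrier: "set us \<subseteq> carrier G" "set vs \<subseteq> carrier G"
    using generators_closed by auto
  then have uv: "u \<in> carrier G" "v \<in> carrier G"
    unfolding u_def v_def by auto
  have "inv x \<otimes> y = u \<otimes> v"
    using foldr_mult_append[OF carrier] ws unfolding us_def vs_def u_def v_def
    by (simp del: foldr_append)
  then have y: "y = x \<otimes> (u \<otimes> v)"
    using inv_solve_left'[of "u \<otimes> v" x y] assms(1,2) uv by simp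
  have "inv y \<otimes> (x \<otimes> u) = inv v \<otimes> (inv u \<otimes> (inv x \<otimes> (x \<otimes> u)))"
    using assms(1) uv unfolding y by (simp add: inv_mult_group m_assoc)
  also have "\<dots> = inv v"
    using assms(1) uv by (simp add: inv_solve_left' m_assoc[symmetric])
  also have "\<dots> = foldr (\<otimes>) (rev (map (m_inv G) vs)) \<one>"
    unfolding v_def by (rule inv_foldr_mult[OF carrier(2)])
  finally have second: "word_length G S (inv y \<otimes> (x \<otimes> u)) \<le> length vs"
    using word_length_le[of "rev (map (m_inv G) vs)" S G] S inv_generator by auto
  have "inv x \<otimes> (x \<otimes> u) = u"
    using assms(1) uv by (simp add: m_assoc[symmetric])
  then have first: "word_length G S (inv x \<otimes> (x \<otimes> u)) \<le> length us"
    using word_length_le[OF S(1), of G] unfolding u_def by simp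
  show thesis
  proof (rule that)
    show "x \<otimes> u \<in> carrier G"
      using assms(1) uv by simp
    show "word_length G S (inv x \<otimes> (x \<otimes> u)) \<le> D div 2"
      using first ws unfolding us_def by simp
    show "word_length G S (inv y \<otimes> (x \<otimes> u)) \<le> D - D div 2"
      using second ws unfolding vs_def by simp
  qed
qed

section \<open>Centres of finite subgroups\<close>

text \<open>
  If \<open>r\<close> is the circumradius of \<open>A\<close>, the last assumption holds and \<open>x\<close> and \<open>y\<close> are centres.
  The summand \<open>1\<close> accounts for words of odd length, which have no exact midpoint.
\<close>

lemma centres_close:
  assumes "hyperbolic_space (carrier G) (word_metric G S) \<delta>"
    and "x \<in> carrier G" "y \<in> carrier G" "A \<subseteq> carrier G"
    and "\<forall>a\<in>A. word_metric G S x a \<le> r" "\<forall>a\<in>A. word_metric G S y a \<le> r"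
    and "\<forall>m\<in>carrier G. \<exists>a\<in>A. r \<le> word_metric G S m a"
  shows "word_metric G S x y \<le> 4 * \<delta> + 1"
proof -
  define D where "D = word_length G S (inv x \<otimes> y)"
  obtain m where m: "m \<in> carrier G"
      "word_length G S (inv x \<otimes> m) \<le> D div 2" "word_length G S (inv y \<otimes> m) \<le> D - D div 2"
    using midpoint_exists[OF assms(2,3)] unfolding D_def by blast
  have "real D \<le> max (word_metric G S x m) (word_metric G S y m) + 2 * \<delta>"
    using hyperbolic_near_centres[OF assms(1-3) m(1) assms(4-6)] assms(7) m(1)
    unfolding D_def word_metric_eq_word_length by blast
  also have "max (word_metric G S x m) (word_metric G S y m) \<le> real (D - D div 2)"
    using m unfolding word_metric_eq_word_length by auto
  finally have "real D \<le> real (D - D div 2) + 2 * \<delta>"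
    by simp
  moreover have "real (2 * (D - D div 2)) \<le> real (D + 1)"
    unfolding of_nat_le_iff by linarith
  then have "2 * real (D - D div 2) \<le> real D + 1"
    by (simp only: of_nat_mult of_nat_add of_nat_numeral of_nat_1)
  ultimately show ?thesis
    unfolding word_metric_eq_word_length D_def[symmetric] by linarith
qed

lemma finite_subgroup_displaces_centre:
  assumes "hyperbolic_space (carrier G) (word_metric G S) \<delta>"
    and "subgroup H G" "finite H"
  obtains x where "x \<in> carrier G"
    and "\<forall>h\<in>H. real (word_length G S (inv x \<otimes> h \<otimes> x)) \<le> 4 * \<delta> + 1"
proof -
  interpret H: subgroup H G
    by fact
  define radius where "radius x = Max ((\<lambda>a. word_length G S (inv x \<otimes> a)) ` H)" for x
  have le_radius: "word_length G S (inv x \<otimes> a) \<le> radius x" if "a \<in> H" for x a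
    using that assms(3) unfolding radius_def by simp
  obtain x where x: "x \<in> carrier G" "\<forall>m. m \<in> carrier G \<longrightarrow> radius x \<le> radius m"
    using ex_has_least_nat[of "\<lambda>x. x \<in> carrier G" \<one> radius] by auto
  have far: "\<exists>a\<in>H. real (radius x) \<le> word_metric G S m a" if m: "m \<in> carrier G" for m
  proof -
    have "radius m \<in> (\<lambda>a. word_length G S (inv m \<otimes> a)) ` H"
      unfolding radius_def using assms(3) H.one_closed by (intro Max_in) blast+
    then obtain a where "a \<in> H" "radius m = word_length G S (inv m \<otimes> a)"
      by blast
    moreover have "radius x \<le> radius m"
      using x(2) m by blast
    ultimately show ?thesis
      unfolding word_metric_eq_word_length by (intro bexI[of _ a]) simp_all
  qed
  have "real (word_length G S (inv x \<otimes> h \<otimes> x)) \<le> 4 * \<delta> + 1" if h: "h \<in> H" for h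
  proof -
    have hc: "h \<in> carrier G"
      using h by simp
    \<comment> \<open>Translating back by \<open>h\<close> shows that \<open>h \<otimes> x\<close> is a centre like \<open>x\<close>.\<close>
    have "word_metric G S (h \<otimes> x) a \<le> real (radius x)" if "a \<in> H" for a
    proof -
      have "inv (h \<otimes> x) \<otimes> a = inv x \<otimes> (inv h \<otimes> a)"
        using that hc x(1) by (simp add: inv_mult_group m_assoc)
      then show ?thesis
        using le_radius[of "inv h \<otimes> a" x] that h unfolding word_metric_eq_word_length by simp
    qed
    moreover have "\<forall>a\<in>H. word_metric G S x a \<le> real (radius x)"
      using le_radius unfolding word_metric_eq_word_length by simp
    ultimately have "word_metric G S x (h \<otimes> x) \<le> 4 * \<delta> + 1"
      using far x(1) hc H.subset by (intro centres_close[OF assms(1), of _ _ H "real (radius x)"]) auto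
    then show ?thesis
      using x(1) hc unfolding word_metric_eq_word_length by (simp add: m_assoc)
  qed
  then show thesis
    using that x(1) by blast
qed

end

section \<open>Conjugacy classes\<close>

lemma conjugate_subgroup_eq_image:
  "conjugate_subgroup G g H = (\<lambda>h. g \<otimes>\<^bsub>G\<^esub> h \<otimes>\<^bsub>G\<^esub> inv\<^bsub>G\<^esub> g) ` H"
  unfolding conjugate_subgroup_def l_coset_def r_coset_def by auto

lemma (in group) conjugate_subgroup_mult:
  assumes "g \<in> carrier G" "k \<in> carrier G" "H \<subseteq> carrier G"
  shows "conjugate_subgroup G g (conjugate_subgroup G k H) = conjugate_subgroup G (g \<otimes> k) H"
  unfolding conjugate_subgroup_eq_image image_image
  using assms by (intro image_cong) (auto simp: inv_mult_group m_assoc subset_iff)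

lemma (in group) orbit_conjugate_subgroup:
  assumes "k \<in> carrier G" "H \<subseteq> carrier G"
  shows "orbit G (conjugate_subgroup G) (conjugate_subgroup G k H)
       = orbit G (conjugate_subgroup G) H"
proof -
  have "orbit G (conjugate_subgroup G) (conjugate_subgroup G k H)
      = (\<lambda>g. conjugate_subgroup G (g \<otimes> k) H) ` carrier G"
    unfolding orbit_def Setcompr_eq_image using assms
    by (simp add: conjugate_subgroup_mult cong: image_cong)
  also have "\<dots> = (\<lambda>g. conjugate_subgroup G g H) ` ((\<lambda>g. g \<otimes> k) ` carrier G)"
    by (simp add: image_image)
  also have "(\<lambda>g. g \<otimes> k) ` carrier G = carrier G"
  proof
    show "carrier G \<subseteq> (\<lambda>g. g \<otimes> k) ` carrier G"
    proof
      fix g assume "g \<in> carrier G"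
      with assms(1) show "g \<in> (\<lambda>g. g \<otimes> k) ` carrier G"
        by (intro image_eqI[of _ _ "g \<otimes> inv k"]) (simp_all add: m_assoc)
    qed
  qed (use assms(1) in auto)
  finally show ?thesis
    unfolding orbit_def by auto
qed

theorem corollary8:
  fixes G :: "('a, 'b) monoid_scheme" and S :: "'a set" and \<delta> :: real
  assumes "group G"
    and "finite S" and "S \<subseteq> carrier G" and "generate G S = carrier G"
    and "set_inv\<^bsub>G\<^esub> S = S" and "\<one>\<^bsub>G\<^esub> \<notin> S"
    and "\<delta> \<ge> 0" and "hyperbolic_space (carrier G) (word_metric G S) \<delta>"
  shows "finite (orbits G (finite_subgroups G) (conjugate_subgroup G))"
proof -
  interpret symmetric_generators G S
    using assms by (simp add: symmetric_generators_def symmetric_generators_axioms_def)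
  define B where "B = {g \<in> carrier G. word_length G S g \<le> nat \<lfloor>4 * \<delta> + 1\<rfloor>}"
  have "orbit G (conjugate_subgroup G) H \<in> orbit G (conjugate_subgroup G) ` Pow B"
    if "H \<in> finite_subgroups G" for H
  proof -
    have H: "subgroup H G" "finite H"
      using that unfolding finite_subgroups_def by auto
    then have sub: "H \<subseteq> carrier G"
      by (simp add: subgroup.subset)
    obtain x where x: "x \<in> carrier G"
        "\<forall>h\<in>H. real (word_length G S (inv\<^bsub>G\<^esub> x \<otimes>\<^bsub>G\<^esub> h \<otimes>\<^bsub>G\<^esub> x)) \<le> 4 * \<delta> + 1"
      using finite_subgroup_displaces_centre[OF assms(8) H] by blast
    have "\<forall>h\<in>H. word_length G S (inv\<^bsub>G\<^esub> x \<otimes>\<^bsub>G\<^esub> h \<otimes>\<^bsub>G\<^esub> x) \<le> nat \<lfloor>4 * \<delta> + 1\<rfloor>"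
      using x(2) le_nat_floor by blast
    then have "conjugate_subgroup G (inv\<^bsub>G\<^esub> x) H \<subseteq> B"
      using x(1) sub unfolding B_def conjugate_subgroup_eq_image by auto
    then show ?thesis
      using orbit_conjugate_subgroup[OF inv_closed[OF x(1)] sub] by (metis PowI imageI)
  qed
  then have "orbits G (finite_subgroups G) (conjugate_subgroup G)
      \<subseteq> orbit G (conjugate_subgroup G) ` Pow B"
    unfolding orbits_def by auto
  moreover have "finite B"
    unfolding B_def using finite_word_length_ball[OF assms(2)] .
  ultimately show ?thesis
    by (meson finite_Pow_iff finite_imageI finite_subset)
qed

end
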